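(* Let $c,d\in\mathbb{D}$ be decimals. The formal limits $$\mathrm{flim}_n\,(c|n+d|n)\quad\text{and}\quad \mathrm{flim}_n\,(c|n\cdot d|n)$$ exist (and thus define the sum $c+d$ and the product $c\cdot d$ of decimals).
   Context: Here $\mathbb{N}=\{1,2,\dots\}$. Decimals. A signed decimal $d$ is a pair of a sign $+$ or $-$ and an infinite string of digits $d=\pm a_ka_{k-1}a_{k-2}\dots$ indexed by the integers $k,k-1,k-2,\dots$, where $k\in\mathbb{Z}$, $a_i\in\{0,1,\dots,9\}\subset\mathbb{Z}$ and $a_k\neq 0$. The zero decimal $0$ has no sign and only zero digits. $\mathbb{D}$ is the set of all decimals (signed and zero). $d_i$ denotes the $i$th digit $a_i$ of $d$, with $d_i=0$ if $a_i$ does not exist. Two decimals are equal iff they have equal signs and $d_i=e_i$ for all $i\in\mathbb{Z}$, or both are zero. Terminating decimals. $\mathbb{T}_0$ is the set of decimals with only finitely many nonzero digits (including $0$), and $\mathbb{Z}_0$ is the set of decimals $d$ with $d_i=0$ for all $i<0$. Decadic notation $0\mapsto 0$, $\pm a_k\dots a_0000\dots\mapsto\pm(a_k10^k+\dots+a_010^0)$ is a bijection $\mathbb{Z}_0\to\mathbb{Z}$, and $+,\cdot$ on $\mathbb{Z}_0$ are transferred from $\mathbb{Z}$ by it. For $d\in\mathbb{D}$ and $k\in\mathbb{Z}$, $10^kd$ is the decimal with the same sign as $d$ and $(10^kd)_i=d_{i-k}$. For $c,d\in\mathbb{T}_0$ define $c+d=10^{-k}(10^kc+10^kd)$ and $c\cdot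 d=10^{-2k}(10^kc\cdot 10^kd)$, where $k$ is any integer with $10^kc,10^kd\in\mathbb{Z}_0$ (the results do not depend on $k$). Formal limits. For $n\in\mathbb{N}$ and $d\in\mathbb{D}$ the truncation $d|n\in\mathbb{T}_0$ has the same sign as $d$ and $(d|n)_i=d_i$ for $i\ge -n$, $(d|n)_i=0$ for $i<-n$; if all its digits are zero, $d|n$ is the zero decimal. A decimal $c$ is the formal limit of a sequence of terminating decimals $c(n)$, $n=1,2,\dots$, written $\mathrm{flim}_n\,c(n)=c$, if for every $k\in\mathbb{N}$ there is $N\in\mathbb{N}$ such that for every $n>N$ the decimals $c$ and $c(n)$ have the same sign or $c$ is zero, and $c(n)|k=c|k$. A formal limit is unique if it exists. *)

theory Defs
  imports Main
begin

datatype sign = Plus | Minus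

text \<open>
  A decimal is a pair of a sign and a digit function; the digit function of \<open>\<plusminus> a\<^sub>k a\<^sub>k\<^sub>-\<^sub>1 \<dots>\<close> is
  extended by 0 beyond the leading position \<open>k\<close>. The sign is \<^const>\<open>None\<close> exactly for the zero
  decimal. Distinct strings are distinct decimals, so \<open>0.999\<dots>\<close> and \<open>1.000\<dots>\<close> differ.
\<close>

typedef decimal =
  "{(s :: sign option, a :: int \<Rightarrow> int).
      (\<forall>i. a i \<in> {0..9}) \<and>
      (if s = None then \<forall>i. a i = 0 else \<exists>k. a k \<noteq> 0 \<and> (\<forall>i>k. a i = 0))}"
  by (rule exI [of _ "(None, \<lambda>_. 0)"]) simp

setup_lifting type_definition_decimal

lift_definition dsign :: "decimal \<Rightarrow> sign option" is fst .

lift_definition digit :: "decimal \<Rightarrow> int \<Rightarrow> int" is snd .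

instantiation decimal :: zero
begin
lift_definition zero_decimal :: decimal is "(None, \<lambda>_. 0)" by simp
instance ..
end

definition \<T>\<^sub>0 :: "decimal set"
  where "\<T>\<^sub>0 = {d. finite {i. digit d i \<noteq> 0}}"

definition \<Z>\<^sub>0 :: "decimal set"
  where "\<Z>\<^sub>0 = {d. \<forall>i<0. digit d i = 0}"

fun sign_int :: "sign option \<Rightarrow> int" where
  "sign_int None = 0"
| "sign_int (Some Plus) = 1"
| "sign_int (Some Minus) = -1"

text \<open>The decadic notation map; meaningful only on \<open>\<Z>\<^sub>0\<close>.\<close>

definition decadic :: "decimal \<Rightarrow> int"
  where "decadic d = sign_int (dsign d) * (\<Sum>i | digit d (int i) \<noteq> 0. digit d (int i) * 10 ^ i)"

definition Z_add :: "decimal \<Rightarrow> decimal \<Rightarrow> decimal"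
  where "Z_add c d = the_inv_into \<Z>\<^sub>0 decadic (decadic c + decadic d)"

definition Z_mult :: "decimal \<Rightarrow> decimal \<Rightarrow> decimal"
  where "Z_mult c d = the_inv_into \<Z>\<^sub>0 decadic (decadic c * decadic d)"

text \<open>\<open>shift k d\<close> is $10^k d$.\<close>

lift_definition shift :: "int \<Rightarrow> decimal \<Rightarrow> decimal"
  is "\<lambda>k (s, a). (s, \<lambda>i. a (i - k))"
proof (clarsimp split: if_splits, elim disjE; clarsimp)
  fix k l :: int and a :: "int \<Rightarrow> int"
  assume "a l \<noteq> 0" "\<forall>i>l. a i = 0"
  then show "\<exists>m. a (m - k) \<noteq> 0 \<and> (\<forall>i>m. a (i - k) = 0)"
    by (intro exI [of _ "l + k"]) auto
qed

text \<open>
  Addition and multiplication of terminating decimals; meaningful only on \<open>\<T>\<^sub>0\<close>, where the results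
  do not depend on the chosen \<open>k\<close> (see \<open>T_add_eq\<close> and \<open>T_mult_eq\<close> below).
\<close>

definition T_add :: "decimal \<Rightarrow> decimal \<Rightarrow> decimal"
  where "T_add c d =
    (let k = (SOME k. shift k c \<in> \<Z>\<^sub>0 \<and> shift k d \<in> \<Z>\<^sub>0)
     in shift (- k) (Z_add (shift k c) (shift k d)))"

definition T_mult :: "decimal \<Rightarrow> decimal \<Rightarrow> decimal"
  where "T_mult c d =
    (let k = (SOME k. shift k c \<in> \<Z>\<^sub>0 \<and> shift k d \<in> \<Z>\<^sub>0)
     in shift (- 2 * k) (Z_mult (shift k c) (shift k d)))"

lift_definition trunc :: "decimal \<Rightarrow> nat \<Rightarrow> decimal"
  is "\<lambda>(s, a) n. if \<forall>i\<ge>- int n. a i = 0 then (None, \<lambda>_. 0)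
        else (s, \<lambda>i. if i \<ge> - int n then a i else 0)"
proof (clarsimp split: if_splits, elim disjE; clarsimp)
  fix a :: "int \<Rightarrow> int" and n :: nat and i k :: int
  assume "- int n \<le> i" "a i \<noteq> 0" "a k \<noteq> 0" and k: "\<forall>i>k. a i = 0"
  moreover from this have "i \<le> k"
    using linorder_not_le by blast
  ultimately show "\<exists>k. (- int n \<le> k \<longrightarrow> a k \<noteq> 0 \<and> (\<forall>i>k. a i = 0)) \<and> - int n \<le> k"
    by (intro exI [of _ k]) auto
qed

text \<open>Sequences are indexed by \<open>1, 2, \<dots>\<close>; the value at index 0 is irrelevant.\<close>

definition is_flim :: "(nat \<Rightarrow> decimal) \<Rightarrow> decimal \<Rightarrow> bool"
  where "is_flim x c \<longleftrightarrow>
    (\<forall>n\<ge>1. x n \<in> \<T>\<^sub>0) \<and>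
    (\<forall>k\<ge>1. \<exists>N\<ge>1. \<forall>n>N. (dsign (x n) = dsign c \<or> c = 0) \<and> trunc (x n) k = trunc c k)"


lemma decimal_eqI: "dsign c = dsign d \<Longrightarrow> (\<And>i. digit c i = digit d i) \<Longrightarrow> c = d"
  by transfer auto

lemma digit_range: "0 \<le> digit d i" "digit d i \<le> 9"
  by (transfer; force)+

lemma digit_zero [simp]: "digit 0 i = 0"
  by transfer simp

lemma dsign_eq_None_iff: "dsign d = None \<longleftrightarrow> d = 0"
  by transfer (auto split: if_splits)

lemma dsign_zero [simp]: "dsign 0 = None"
  by (simp add: dsign_eq_None_iff)

lemma decimal_zero_iff: "d = 0 \<longleftrightarrow> (\<forall>i. digit d i = 0)"
  by transfer (auto split: if_splits)

lemma digit_bounded: "\<exists>k. \<forall>i>k. digit d i = 0"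
  by transfer (force split: if_splits)

lemma dsign_shift [simp]: "dsign (shift k d) = dsign d"
  by transfer auto

lemma digit_shift [simp]: "digit (shift k d) i = digit d (i - k)"
  by transfer auto

lemma digit_trunc: "digit (trunc d n) i = (if i \<ge> - int n then digit d i else 0)"
  by transfer auto

lemma dsign_trunc: "dsign (trunc d n) = (if \<forall>i\<ge>- int n. digit d i = 0 then None else dsign d)"
  by transfer auto

lemma trunc_in_T0: "trunc d n \<in> \<T>\<^sub>0"
proof -
  obtain k where "\<forall>i>k. digit d i = 0"
    using digit_bounded by blast
  then have "{i. digit (trunc d n) i \<noteq> 0} \<subseteq> {- int n..k}"
    by (force simp: digit_trunc split: if_splits)
  then show ?thesis
    unfolding \<T>\<^sub>0_def using finite_subset by blast
qed

lemma flim_unique: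
  assumes "is_flim x c" "is_flim x d"
  shows "c = d"
proof -
  have ex: "\<exists>n. (dsign (x n) = dsign c \<or> c = 0) \<and> (dsign (x n) = dsign d \<or> d = 0)
              \<and> trunc c k = trunc d k" if "k \<ge> 1" for k
  proof -
    obtain M where
      "\<forall>n>M. (dsign (x n) = dsign c \<or> c = 0) \<and> trunc (x n) k = trunc c k"
      using \<open>k \<ge> 1\<close> assms(1) unfolding is_flim_def by blast
    moreover obtain N where
      "\<forall>n>N. (dsign (x n) = dsign d \<or> d = 0) \<and> trunc (x n) k = trunc d k"
      using \<open>k \<ge> 1\<close> assms(2) unfolding is_flim_def by blast
    moreover have "Suc (M + N) > M" "Suc (M + N) > N"
      by auto
    ultimately show ?thesis
      by metis
  qed
  have dig: "digit c i = digit d i" for i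
  proof -
    obtain k where k: "k \<ge> 1" "- int k \<le> i"
      by (rule that [of "nat \<bar>i\<bar> + 1"]) auto
    have "digit (trunc c k) i = digit (trunc d k) i"
      using ex [OF k(1)] by auto
    then show ?thesis
      using k(2) by (simp add: digit_trunc)
  qed
  show ?thesis
  proof (cases "c = 0 \<or> d = 0")
    case True
    then show ?thesis using dig decimal_zero_iff by metis
  next
    case False
    then have "dsign c = dsign d"
      using ex [of 1] by auto
    then show ?thesis using dig by (rule decimal_eqI)
  qed
qed

lemma digit_sum_div_mod:
  fixes a :: "nat \<Rightarrow> int"
  assumes "\<And>i. 0 \<le> a i" "\<And>i. a i \<le> 9"
  shows "(\<Sum>i<m. a i * 10 ^ i) div 10 ^ j mod 10 = (if j < m then a j else 0)"
  using assms
proof (induction m arbitrary: a j)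
  case 0
  then show ?case by simp
next
  case (Suc m)
  define S where "S = (\<Sum>i<m. a (Suc i) * 10 ^ i)"
  have split: "(\<Sum>i<Suc m. a i * 10 ^ i) = a 0 + 10 * S"
    unfolding S_def sum.lessThan_Suc_shift by (simp add: sum_distrib_left mult_ac)
  have a0: "0 \<le> a 0" "a 0 < 10"
    using Suc.prems(1) [of 0] Suc.prems(2) [of 0] by auto
  show ?case
  proof (cases j)
    case 0
    then show ?thesis unfolding split using a0 by simp
  next
    case (Suc l)
    have "(a 0 + 10 * S) div 10 ^ Suc l = (a 0 + 10 * S) div 10 div 10 ^ l"
      by (simp add: zdiv_zmult2_eq)
    also have "\<dots> = S div 10 ^ l"
      using a0 by simp
    finally show ?thesis
      unfolding split Suc using Suc.IH [of "\<lambda>i. a (Suc i)" l] Suc.prems by (simp add: S_def)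
  qed
qed

lemma digit_sum_of_int: "(\<Sum>i<m. (n div 10 ^ i mod 10) * 10 ^ i) = n mod (10 ^ m :: int)"
proof (induction m)
  case (Suc m)
  have "n mod 10 ^ Suc m = n mod (10 ^ m * 10)"
    by (simp add: mult.commute)
  then show ?case
    using Suc by (simp only: zmod_zmult2_eq sum.lessThan_Suc) simp
qed simp

lemma decadic_lessThan:
  obtains m where "\<forall>i\<ge>m. digit d (int i) = 0"
    "(\<Sum>i | digit d (int i) \<noteq> 0. digit d (int i) * 10 ^ i) = (\<Sum>i<m. digit d (int i) * 10 ^ i)"
proof -
  obtain k where k: "\<forall>i>k. digit d i = 0"
    using digit_bounded by blast
  define m where "m = nat (k + 1)"
  have m: "digit d (int i) = 0" if "i \<ge> m" for i
    using k that unfolding m_def by (simp add: nat_le_iff)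
  then have "(\<Sum>i | digit d (int i) \<noteq> 0. digit d (int i) * 10 ^ i) = (\<Sum>i<m. digit d (int i) * 10 ^ i)"
    by (intro sum.mono_neutral_left) (auto simp: not_le [symmetric])
  with m show ?thesis
    using that by blast
qed

lemma digit_abs_decadic: "digit d (int j) = \<bar>decadic d\<bar> div 10 ^ j mod 10"
proof (cases "d = 0")
  case True
  then show ?thesis by (simp add: decadic_def)
next
  case False
  obtain m where m: "\<forall>i\<ge>m. digit d (int i) = 0"
    "(\<Sum>i | digit d (int i) \<noteq> 0. digit d (int i) * 10 ^ i) = (\<Sum>i<m. digit d (int i) * 10 ^ i)"
    by (rule decadic_lessThan)
  have "\<bar>sign_int (dsign d)\<bar> = 1"
    using False by (cases "dsign d" rule: sign_int.cases) (auto simp: dsign_eq_None_iff)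
  moreover have "0 \<le> (\<Sum>i<m. digit d (int i) * 10 ^ i)"
    by (intro sum_nonneg) (simp add: digit_range)
  ultimately have "\<bar>decadic d\<bar> = (\<Sum>i<m. digit d (int i) * 10 ^ i)"
    by (simp add: decadic_def m(2) abs_mult)
  then show ?thesis
    using digit_sum_div_mod [of "\<lambda>i. digit d (int i)" m j] m(1) digit_range by auto
qed

lemma decadic_eq_0_iff: "d \<in> \<Z>\<^sub>0 \<Longrightarrow> decadic d = 0 \<longleftrightarrow> d = 0"
proof
  assume "d \<in> \<Z>\<^sub>0" "decadic d = 0"
  then have "digit d i = 0" for i
    using digit_abs_decadic [of d "nat i"] by (cases "i < 0") (auto simp: \<Z>\<^sub>0_def)
  then show "d = 0"
    by (simp add: decimal_zero_iff)
qed (simp add: decadic_def)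

lemma sgn_decadic:
  assumes "d \<in> \<Z>\<^sub>0"
  shows "sgn (decadic d) = sign_int (dsign d)"
proof (cases "d = 0")
  case True
  then show ?thesis by (simp add: decadic_def)
next
  case False
  have "0 \<le> (\<Sum>i | digit d (int i) \<noteq> 0. digit d (int i) * 10 ^ i)" (is "0 \<le> ?S")
    by (intro sum_nonneg) (simp add: digit_range)
  moreover have "decadic d \<noteq> 0"
    using False assms decadic_eq_0_iff by blast
  ultimately have "0 < ?S"
    unfolding decadic_def by (metis mult_zero_right order_le_less)
  then show ?thesis
    by (cases "dsign d" rule: sign_int.cases) (auto simp: decadic_def sgn_mult)
qed

lemma ex_decimal:
  fixes a :: "int \<Rightarrow> int"
  assumes "\<And>i. 0 \<le> a i \<and> a i \<le> 9" "a j \<noteq> 0" "\<And>i. i > k \<Longrightarrow> a i = 0"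
  obtains d where "dsign d = Some s" "digit d = a"
proof -
  have fin: "finite {i. j \<le> i \<and> a i \<noteq> 0}"
    by (rule finite_subset [of _ "{j..k}"]) (use assms(3) leI in force)+
  define m where "m = Max {i. j \<le> i \<and> a i \<noteq> 0}"
  have "m \<in> {i. j \<le> i \<and> a i \<noteq> 0}"
    unfolding m_def using assms(2) by (intro Max_in fin) auto
  moreover have "a i = 0" if "i > m" for i
    using Max_ge [OF fin, of i] that calculation unfolding m_def by force
  ultimately have "(Some s, a) \<in> {(s, a). (\<forall>i. a i \<in> {0..9}) \<and>
      (if s = None then \<forall>i. a i = 0 else \<exists>k. a k \<noteq> 0 \<and> (\<forall>i>k. a i = 0))}"
    using assms(1) by auto
  then show ?thesis
    using that [of "Abs_decimal (Some s, a)"]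
    by (simp add: dsign.rep_eq digit.rep_eq Abs_decimal_inverse)
qed

lemma decadic_bij: "bij_betw decadic \<Z>\<^sub>0 UNIV"
proof (rule bij_betwI')
  fix c d assume Z: "c \<in> \<Z>\<^sub>0" "d \<in> \<Z>\<^sub>0"
  show "decadic c = decadic d \<longleftrightarrow> c = d"
  proof
    assume eq: "decadic c = decadic d"
    have "digit c i = digit d i" for i
      using Z digit_abs_decadic [of c "nat i"] digit_abs_decadic [of d "nat i"] eq
      by (cases "i < 0") (auto simp: \<Z>\<^sub>0_def)
    moreover have "sign_int (dsign c) = sign_int (dsign d)"
      using eq Z sgn_decadic by metis
    then have "dsign c = dsign d"
      by (cases "dsign c" rule: sign_int.cases; cases "dsign d" rule: sign_int.cases) auto
    ultimately show "c = d"
      using decimal_eqI by blast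
  qed simp
next
  fix n :: int
  show "\<exists>d\<in>\<Z>\<^sub>0. n = decadic d"
  proof (cases "n = 0")
    case True
    then show ?thesis
      by (intro bexI [of _ 0]) (auto simp: decadic_def \<Z>\<^sub>0_def)
  next
    case False
    define s where "s = (if n > 0 then Plus else Minus)"
    define a where "a = (\<lambda>i. if i < 0 then 0 else \<bar>n\<bar> div 10 ^ nat i mod 10)"
    obtain m where lt: "\<bar>n\<bar> < 10 ^ m"
    proof
      have "nat \<bar>n\<bar> < 10 ^ nat \<bar>n\<bar>"
        by (rule power_gt_expt) simp
      then have "int (nat \<bar>n\<bar>) < int (10 ^ nat \<bar>n\<bar>)"
        by (simp only: of_nat_less_iff)
      then show "\<bar>n\<bar> < 10 ^ nat \<bar>n\<bar>"
        by simp
    qed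
    have sum: "(\<Sum>i<l. a (int i) * 10 ^ i) = \<bar>n\<bar> mod 10 ^ l" for l
      using digit_sum_of_int [of "\<bar>n\<bar>" l] by (simp add: a_def)
    have big: "a (int i) = 0" if "i \<ge> m" for i
    proof -
      have "\<bar>n\<bar> < 10 ^ i"
        using lt that by (meson less_le_trans one_le_numeral power_increasing)
      then show ?thesis
        by (simp add: a_def)
    qed
    have "\<exists>j. a j \<noteq> 0"
    proof (rule ccontr)
      assume "\<nexists>j. a j \<noteq> 0"
      then show False
        using sum [of m] lt False by simp
    qed
    then obtain j where j: "a j \<noteq> 0"
      by blast
    have big': "a i = 0" if "i > int m" for i
      using big [of "nat i"] that by simp
    obtain d where d: "dsign d = Some s" "digit d = a"
      by (rule ex_decimal [of a j "int m" s]) (use j big' in \<open>auto simp: a_def\<close>)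
    have "(\<Sum>i | a (int i) \<noteq> 0. a (int i) * 10 ^ i) = (\<Sum>i<m. a (int i) * 10 ^ i)"
      by (intro sum.mono_neutral_left) (use big not_le in auto)
    also have "\<dots> = \<bar>n\<bar>"
      using sum [of m] lt by simp
    finally have "decadic d = n"
      using False by (simp add: decadic_def d s_def)
    moreover have "d \<in> \<Z>\<^sub>0"
      by (simp add: \<Z>\<^sub>0_def d a_def)
    ultimately show ?thesis
      by blast
  qed
qed simp

lemma the_inv_decadic:
  "the_inv_into \<Z>\<^sub>0 decadic n \<in> \<Z>\<^sub>0" "decadic (the_inv_into \<Z>\<^sub>0 decadic n) = n"
  using decadic_bij
  by (auto simp: bij_betw_def intro: the_inv_into_into f_the_inv_into_f)

lemma the_inv_decadic_eqI: "d \<in> \<Z>\<^sub>0 \<Longrightarrow> decadic d = n \<Longrightarrow> the_inv_into \<Z>\<^sub>0 decadic n = d"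
  using decadic_bij by (auto simp: bij_betw_def the_inv_into_f_f)

lemma shift_shift [simp]: "shift k (shift l d) = shift (k + l) d"
  by (rule decimal_eqI) (simp_all add: algebra_simps)

lemma shift_in_Z0: "d \<in> \<Z>\<^sub>0 \<Longrightarrow> shift (int j) d \<in> \<Z>\<^sub>0"
  by (simp add: \<Z>\<^sub>0_def)

lemma decadic_shift:
  assumes "d \<in> \<Z>\<^sub>0"
  shows "decadic (shift (int j) d) = 10 ^ j * decadic d"
proof -
  have "{i. digit d (int i - int j) \<noteq> 0} = (\<lambda>i. i + j) ` {i. digit d (int i) \<noteq> 0}" (is "?A = ?B")
  proof
    show "?A \<subseteq> ?B"
    proof
      fix i assume i: "i \<in> ?A"
      then have "j \<le> i"
        using assms by (auto simp: \<Z>\<^sub>0_def not_less [symmetric])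
      then show "i \<in> ?B"
        using i by (intro image_eqI [of _ _ "i - j"]) (auto simp: of_nat_diff)
    qed
  qed auto
  then have "(\<Sum>i | digit d (int i - int j) \<noteq> 0. digit d (int i - int j) * 10 ^ i)
      = (\<Sum>i | digit d (int i) \<noteq> 0. 10 ^ j * (digit d (int i) * 10 ^ i))"
    by (simp add: sum.reindex power_add mult_ac)
  then show ?thesis
    by (simp add: decadic_def sum_distrib_left mult_ac)
qed

lemma ex_shift_in_Z0:
  assumes "c \<in> \<T>\<^sub>0" "d \<in> \<T>\<^sub>0"
  shows "\<exists>k. shift k c \<in> \<Z>\<^sub>0 \<and> shift k d \<in> \<Z>\<^sub>0"
proof -
  have "finite ({i. digit c i \<noteq> 0} \<union> {i. digit d i \<noteq> 0})"
    using assms by (simp add: \<T>\<^sub>0_def)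
  then obtain m where m: "\<And>i. i \<in> {i. digit c i \<noteq> 0} \<union> {i. digit d i \<noteq> 0} \<Longrightarrow> m \<le> i"
    using bdd_below_finite unfolding bdd_below_def by meson
  then show ?thesis
    by (intro exI [of _ "- m"]) (force simp: \<Z>\<^sub>0_def)
qed

lemma Z_add_shift:
  assumes "c \<in> \<Z>\<^sub>0" "d \<in> \<Z>\<^sub>0"
  shows "Z_add (shift (int j) c) (shift (int j) d) = shift (int j) (Z_add c d)"
  unfolding Z_add_def
  by (rule the_inv_decadic_eqI)
     (simp_all add: assms shift_in_Z0 the_inv_decadic decadic_shift algebra_simps)

lemma Z_mult_shift:
  assumes "c \<in> \<Z>\<^sub>0" "d \<in> \<Z>\<^sub>0"
  shows "Z_mult (shift (int j) c) (shift (int j) d) = shift (int (2 * j)) (Z_mult c d)"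
  unfolding Z_mult_def
  by (rule the_inv_decadic_eqI)
     (simp_all only: assms shift_in_Z0 the_inv_decadic decadic_shift,
      simp add: mult_2 mult_2_right power_add mult_ac)

lemma T_add_eq:
  assumes "shift k c \<in> \<Z>\<^sub>0" "shift k d \<in> \<Z>\<^sub>0"
  shows "T_add c d = shift (- k) (Z_add (shift k c) (shift k d))"
proof -
  have le: "shift (- l) (Z_add (shift l c) (shift l d)) = shift (- k) (Z_add (shift k c) (shift k d))"
    if "shift k c \<in> \<Z>\<^sub>0" "shift k d \<in> \<Z>\<^sub>0" "k \<le> l" for k l
    using Z_add_shift [OF that(1,2), of "nat (l - k)"] that(3) by simp
  define l where "l = (SOME k. shift k c \<in> \<Z>\<^sub>0 \<and> shift k d \<in> \<Z>\<^sub>0)"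
  have l: "shift l c \<in> \<Z>\<^sub>0 \<and> shift l d \<in> \<Z>\<^sub>0"
    unfolding l_def by (rule someI [of _ k]) (simp add: assms)
  have "T_add c d = shift (- l) (Z_add (shift l c) (shift l d))"
    by (simp only: T_add_def Let_def l_def)
  also have "\<dots> = shift (- k) (Z_add (shift k c) (shift k d))"
    using le [of k l] le [of l k] l assms by (cases "k \<le> l") auto
  finally show ?thesis .
qed

lemma T_mult_eq:
  assumes "shift k c \<in> \<Z>\<^sub>0" "shift k d \<in> \<Z>\<^sub>0"
  shows "T_mult c d = shift (- 2 * k) (Z_mult (shift k c) (shift k d))"
proof -
  have le: "shift (- 2 * l) (Z_mult (shift l c) (shift l d))
      = shift (- 2 * k) (Z_mult (shift k c) (shift k d))"
    if "shift k c \<in> \<Z>\<^sub>0" "shift k d \<in> \<Z>\<^sub>0" "k \<le> l" for k l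
    using Z_mult_shift [OF that(1,2), of "nat (l - k)"] that(3) by simp
  define l where "l = (SOME k. shift k c \<in> \<Z>\<^sub>0 \<and> shift k d \<in> \<Z>\<^sub>0)"
  have l: "shift l c \<in> \<Z>\<^sub>0 \<and> shift l d \<in> \<Z>\<^sub>0"
    unfolding l_def by (rule someI [of _ k]) (simp add: assms)
  have "T_mult c d = shift (- 2 * l) (Z_mult (shift l c) (shift l d))"
    by (simp only: T_mult_def Let_def l_def)
  also have "\<dots> = shift (- 2 * k) (Z_mult (shift k c) (shift k d))"
    using le [of k l] le [of l k] l assms by (cases "k \<le> l") auto
  finally show ?thesis .
qed

end

(*
  Scale the n-th partial sum or product to an integer A n. If the terms do not cancel
  (sums of equal signs, products), \<bar>A n\<bar> read at a fixed decimal position is nondecreasing and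
  bounded, hence eventually constant. For a sum of opposite signs, A (n+1) = 10 A n + e with
  \<bar>e\<bar> \<le> 9: such a recursion never changes sign after the first nonzero term. Applied to A this
  fixes the sign; applied to \<bar>A n\<bar> - 10^(n-k) \<bar>A k\<bar> it decides whether truncation at position k
  borrows from \<bar>A k\<bar> or not.
*)
theory Submission
  imports Defs
begin

section \<open>Formal limits from eventually constant signs and digits\<close>

text \<open>The limit collects the final value of each digit. A threshold uniform in all
  \<open>i >= - int k\<close> gives agreement of whole truncations and bounds the leading position
  of the limit.\<close>

lemma flim_exists_if_digits_stabilise:
  assumes T0: "\<And>n. x n \<in> \<T>\<^sub>0"
    and sign: "\<exists>N. \<forall>n\<ge>N. dsign (x n) = dsign (x N)"
    and digits: "\<And>k::nat. \<exists>N. \<forall>n\<ge>N. \<forall>i\<ge>- int k. digit (x n) i = digit (x N) i"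
  shows "\<exists>c. is_flim x c"
proof -
  obtain N where N: "\<And>k n i. n \<ge> N k \<Longrightarrow> i \<ge> - int k \<Longrightarrow> digit (x n) i = digit (x (N k)) i"
    using digits by metis
  obtain S where S: "\<And>n. n \<ge> S \<Longrightarrow> dsign (x n) = dsign (x S)"
    using sign by blast
  \<comment> \<open>Position \<open>i\<close> is settled by the threshold for
    \<open>k = nat (- i)\<close>, the least \<open>k\<close> with
    \<open>i >= - int k\<close>.\<close>
  define a where "a i = digit (x (N (nat (- i)))) i" for i
  have a: "digit (x n) i = a i" if "n \<ge> N k" "i \<ge> - int k" for n k i
  proof -
    let ?m = "max n (N (nat (- i)))"
    have "digit (x n) i = digit (x ?m) i"
      using N [OF that] N [of k ?m i] that by simp
    also have "\<dots> = a i"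
      unfolding a_def by (rule N) auto
    finally show ?thesis .
  qed
  have flim: "is_flim x c" if c: "digit c = a" and s: "c = 0 \<or> dsign c = dsign (x S)" for c
  proof -
    have "(dsign (x n) = dsign c \<or> c = 0) \<and> trunc (x n) k = trunc c k"
      if n: "n > max 1 (max S (N k))" for n k
    proof
      have dg: "digit (x n) i = digit c i" if "i \<ge> - int k" for i
        using a [of k n i] n that c by simp
      show sg: "dsign (x n) = dsign c \<or> c = 0"
        using S [of n] n s by auto
      show "trunc (x n) k = trunc c k"
        by (rule decimal_eqI) (use dg sg in \<open>auto simp: digit_trunc dsign_trunc\<close>)
    qed
    then show ?thesis
      unfolding is_flim_def using T0 by (meson max.cobounded1)
  qed
  show ?thesis
  \<comment> \<open>If every final digit is 0, the limit is the zero decimal and the sign of the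
    terms is irrelevant. Otherwise a nonzero digit rules out \<open>None\<close> as the final
    sign.\<close>
  proof (cases "\<forall>i. a i = 0")
    case True
    then show ?thesis
      using flim [of 0] by (auto simp: fun_eq_iff)
  next
    case False
    then obtain j where j: "a j \<noteq> 0" by blast
    \<comment> \<open>From index \<open>N 0\<close> on, all digits at positions
      \<open>i >= 0\<close> are final, so the leading position of this single term bounds that of
      the limit.\<close>
    obtain K where K: "\<forall>i>K. digit (x (N 0)) i = 0"
      using digit_bounded by blast
    have "a i = 0" if "i > max K 0" for i
      using a [of 0 "N 0" i] K that by simp
    moreover have "dsign (x S) \<noteq> None"
    proof -
      have "digit (x (max S (N (nat (- j))))) j \<noteq> 0"
        using a [of "nat (- j)" "max S (N (nat (- j)))" j] j by simp
      then show ?thesis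
        using S [of "max S (N (nat (- j)))"] dsign_eq_None_iff digit_zero by (metis max.cobounded1)
    qed
    then obtain s where "dsign (x S) = Some s" by blast
    moreover have "0 \<le> a i \<and> a i \<le> 9" for i
      unfolding a_def by (simp add: digit_range)
    ultimately show ?thesis
      using flim ex_decimal [of a j "max K 0" s] j by metis
  qed
qed

lemma shift_in_Z0_imp_T0: "shift p d \<in> \<Z>\<^sub>0 \<Longrightarrow> d \<in> \<T>\<^sub>0"
proof -
  assume Z: "shift p d \<in> \<Z>\<^sub>0"
  obtain K where "\<forall>i>K. digit d i = 0"
    using digit_bounded by blast
  moreover have "digit d i = 0" if "i < - p" for i
    using Z [unfolded \<Z>\<^sub>0_def] that by (auto dest!: spec [of _ "i + p"])
  ultimately have "{i. digit d i \<noteq> 0} \<subseteq> {- p..K}"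
    by (force simp flip: not_less)
  then show ?thesis
    unfolding \<T>\<^sub>0_def using finite_subset by blast
qed

text \<open>Here \<open>\<bar>A n\<bar> div 10 ^ (r * n - k)\<close> is $|x_n|\,10^k$ rounded down.\<close>

lemma flim_exists_if_scaled_stabilise:
  assumes r: "r > 0"
    and Z0: "\<And>n. shift (int (r * n)) (x n) \<in> \<Z>\<^sub>0"
    and A: "\<And>n. decadic (shift (int (r * n)) (x n)) = A n"
    and sgn: "\<exists>N. \<forall>n\<ge>N. sgn (A n) = sgn (A N)"
    and quot: "\<And>k. \<exists>N g. \<forall>n\<ge>N. \<bar>A n\<bar> div 10 ^ (r * n - k) = g"
  shows "\<exists>c. is_flim x c"
proof (rule flim_exists_if_digits_stabilise)
  show "x n \<in> \<T>\<^sub>0" for n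
    using Z0 shift_in_Z0_imp_T0 by blast
  have "sign_int (dsign (x n)) = sgn (A n)" for n
    using sgn_decadic [OF Z0 [of n]] A by simp
  moreover have "inj sign_int"
  proof (rule injI)
    show "s = t" if "sign_int s = sign_int t" for s t
      using that by (cases s rule: sign_int.cases; cases t rule: sign_int.cases) auto
  qed
  ultimately show "\<exists>N. \<forall>n\<ge>N. dsign (x n) = dsign (x N)"
    using sgn by (metis injD)
next
  fix k :: nat
  obtain N g where N: "\<And>n. n \<ge> N \<Longrightarrow> \<bar>A n\<bar> div 10 ^ (r * n - k) = g"
    using quot by blast
  have "digit (x n) i = g div 10 ^ nat (i + int k) mod 10"
    if "n \<ge> max N k" "i \<ge> - int k" for n i
  proof -
    \<comment> \<open>This is why \<open>n >= k\<close> is required: the natural subtraction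
      \<open>r * n - k\<close> must not be cut off at 0.\<close>
    have "k \<le> r * n"
      using r that by (metis One_nat_def Suc_leI max.bounded_iff mult_le_mono nat_mult_1)
    have eq: "nat (i + int (r * n)) = (r * n - k) + nat (i + int k)"
      using that \<open>k \<le> r * n\<close> by arith
    have "int (nat (i + int (r * n))) = i + int (r * n)"
      using \<open>k \<le> r * n\<close> that by arith
    then have "digit (x n) i = digit (shift (int (r * n)) (x n)) (int (nat (i + int (r * n))))"
      by (simp only: digit_shift add_diff_cancel_right')
    also have "\<dots> = \<bar>A n\<bar> div 10 ^ (r * n - k) div 10 ^ nat (i + int k) mod 10"
      unfolding digit_abs_decadic A eq power_add by (subst zdiv_zmult2_eq) auto
    finally show ?thesis
      using N that by simp
  qed
  then show "\<exists>N. \<forall>n\<ge>N. \<forall>i\<ge>- int k. digit (x n) i = digit (x N) i"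
    by (metis order_refl)
qed

section \<open>Stabilisation of integer sequences\<close>

lemma mono_bounded_int_eventually_const:
  fixes f :: "nat \<Rightarrow> int"
  assumes mono: "\<And>n. n \<ge> m \<Longrightarrow> f n \<le> f (Suc n)" and bound: "\<And>n. n \<ge> m \<Longrightarrow> f n \<le> B"
  shows "\<exists>N g. \<forall>n\<ge>N. f n = g"
proof -
  \<comment> \<open>Minimising the distance to \<open>B\<close> selects an index where
    \<open>f\<close> is maximal; monotonicity keeps it there.\<close>
  obtain N where N: "N \<ge> m" "\<And>n. n \<ge> m \<Longrightarrow> nat (B - f N) \<le> nat (B - f n)"
    using ex_has_least_nat [of "\<lambda>n. n \<ge> m" m "\<lambda>n. nat (B - f n)"] by auto
  have "f N \<le> f n" if "n \<ge> N" for n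
    using that
  proof (induction rule: dec_induct)
    case (step n)
    then show ?case using mono [of n] N(1) by linarith
  qed simp
  moreover have "f n \<le> f N" if "n \<ge> N" for n
    using N(2) [of n] bound [of n] bound [of N] N(1) that by linarith
  ultimately show ?thesis
    by (metis order_antisym)
qed

text \<open>By \<open>step\<close>, |A n| / 10^(r n) is nondecreasing, and \<open>B\<close> bounds
  it. Multiplying by 10^k and rounding down preserves both properties.\<close>

lemma superhomogeneous_quotient_stabilises:
  fixes A :: "nat \<Rightarrow> int"
  assumes r: "r > 0"
    and step: "\<And>n. 10 ^ r * \<bar>A n\<bar> \<le> \<bar>A (Suc n)\<bar>"
    and bound: "\<And>n. \<bar>A n\<bar> \<le> B * 10 ^ (r * n)"
  shows "\<exists>N g. \<forall>n\<ge>N. \<bar>A n\<bar> div 10 ^ (r * n - k) = g"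
proof (rule mono_bounded_int_eventually_const [of k])
  fix n assume "n \<ge> k"
  then have le: "k \<le> r * n"
    using r by (metis One_nat_def Suc_leI mult_le_mono nat_mult_1)
  have "\<bar>A n\<bar> div 10 ^ (r * n - k) = (10 ^ r * \<bar>A n\<bar>) div (10 ^ r * 10 ^ (r * n - k))"
    by simp
  also have "\<dots> \<le> \<bar>A (Suc n)\<bar> div (10 ^ r * 10 ^ (r * n - k))"
    using step by (intro zdiv_mono1) auto
  also have "10 ^ r * 10 ^ (r * n - k) = (10 ^ (r * Suc n - k) :: int)"
    using le by (simp flip: power_add)
  finally show "\<bar>A n\<bar> div 10 ^ (r * n - k) \<le> \<bar>A (Suc n)\<bar> div 10 ^ (r * Suc n - k)" .
  have "\<bar>A n\<bar> \<le> B * 10 ^ k * 10 ^ (r * n - k)"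
    using bound [of n] le by (simp add: mult.assoc flip: power_add)
  then have "\<bar>A n\<bar> div 10 ^ (r * n - k) \<le> B * 10 ^ k * 10 ^ (r * n - k) div 10 ^ (r * n - k)"
    by (intro zdiv_mono1) auto
  then show "\<bar>A n\<bar> div 10 ^ (r * n - k) \<le> B * 10 ^ k"
    by simp
qed

lemma superhomogeneous_sgn:
  fixes A :: "nat \<Rightarrow> int"
  assumes "\<And>n. 10 ^ r * \<bar>A n\<bar> \<le> \<bar>A (Suc n)\<bar>" and sgn: "\<And>n. A n = 0 \<or> sgn (A n) = s"
  shows "\<exists>N. \<forall>n\<ge>N. sgn (A n) = sgn (A N)"
proof (cases "\<forall>n. A n = 0")
  case False
  then obtain N where "A N \<noteq> 0" by blast
  have "A n \<noteq> 0" if "n \<ge> N" for n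
    using that
  proof (induction rule: dec_induct)
    case (step n)
    then have "0 < 10 ^ r * \<bar>A n\<bar>" by simp
    then show ?case using assms(1) [of n] by linarith
  qed (rule \<open>A N \<noteq> 0\<close>)
  then show ?thesis
    using sgn by (metis order_refl)
qed simp

text \<open>A nonzero integer \<open>A n\<close> gives |10 * A n| >= 10 > |e n|, so the added term
  can neither cancel nor reverse it.\<close>

lemma digit_recursion_sgn_stabilises:
  fixes A :: "nat \<Rightarrow> int"
  assumes step: "\<And>n. n \<ge> m \<Longrightarrow> A (Suc n) = 10 * A n + e n" and e: "\<And>n. \<bar>e n\<bar> \<le> 9"
  shows "\<exists>N\<ge>m. \<forall>n\<ge>N. sgn (A n) = sgn (A N)"
proof (cases "\<forall>n\<ge>m. A n = 0")
  case False
  then obtain N where N: "N \<ge> m" "A N \<noteq> 0" by blast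
  have "sgn (A n) = sgn (A N)" if "n \<ge> N" for n
    using that
  proof (induction rule: dec_induct)
    case (step n)
    then have "A n \<noteq> 0"
      using N by (metis sgn_eq_0_iff)
    then have "sgn (A (Suc n)) = sgn (A n)"
      using assms(1) [of n] e [of n] step(1) N(1) unfolding sgn_if by arith
    then show ?case using step by simp
  qed simp
  then show ?thesis using N by blast
qed auto

text \<open>Monotonicity may fail here, since \<open>e n\<close> can have the sign opposite to
  \<open>A n\<close>. Everything appended after index \<open>l\<close> amounts to less than one unit
  at position \<open>l\<close>, so only the sign of that remainder matters.\<close>

lemma digit_recursion_quotient_stabilises:
  fixes A :: "nat \<Rightarrow> int"
  assumes step: "\<And>n. A (Suc n) = 10 * A n + e n" and e: "\<And>n. \<bar>e n\<bar> \<le> 9"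
  shows "\<exists>N g. \<forall>n\<ge>N. \<bar>A n\<bar> div 10 ^ (n - k) = g"
proof -
  obtain M where M: "\<forall>n\<ge>M. sgn (A n) = sgn (A M)"
    using digit_recursion_sgn_stabilises [of 0 A e] step e by blast
  \<comment> \<open>\<open>l >= M\<close> makes the sign of \<open>A\<close> constant, so that |A|
    obeys a recursion of the same kind; \<open>l >= k\<close> lets the quotient at position
    \<open>k\<close> be computed from the one at position \<open>l\<close>.\<close>
  define l where "l = max k M"
  define f where "f n = sgn (A M) * e n" for n
  have f: "\<bar>f n\<bar> \<le> 9" for n
    using e [of n] by (auto simp: f_def abs_mult sgn_if)
  have abs_step: "\<bar>A (Suc n)\<bar> = 10 * \<bar>A n\<bar> + f n" if "n \<ge> l" for n
  proof -
    have "\<bar>A i\<bar> = sgn (A M) * A i" if "i \<ge> M" for i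
      using M that by (metis abs_sgn mult.commute)
    then have "\<bar>A (Suc n)\<bar> = sgn (A M) * A (Suc n)" "\<bar>A n\<bar> = sgn (A M) * A n"
      using that by (simp_all add: l_def)
    then show ?thesis
      unfolding step f_def by (simp only: algebra_simps)
  qed
  define T where "T n = \<bar>A n\<bar> - 10 ^ (n - l) * \<bar>A l\<bar>" for n
  have T_step: "T (Suc n) = 10 * T n + f n" if "n \<ge> l" for n
    using abs_step [OF that] that by (simp add: T_def Suc_diff_le algebra_simps)
  \<comment> \<open>Over the integers the strict bound leaves a gap of 1, and 10 * (10^j - 1) + 9 =
    10^(j+1) - 1.\<close>
  have T_bound: "\<bar>T n\<bar> < 10 ^ (n - l)" if "n \<ge> l" for n
    using that
  proof (induction rule: dec_induct)
    case (step n)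
    then show ?case
      using T_step [of n] f [of n] by (simp add: Suc_diff_le)
  qed (simp add: T_def)
  obtain N where N: "N \<ge> l" "\<forall>n\<ge>N. sgn (T n) = sgn (T N)"
    using digit_recursion_sgn_stabilises [of l T f] T_step f by blast
  \<comment> \<open>A negative remainder \<open>T n\<close> borrows one unit from |A l|.\<close>
  define h where "h = (if T N < 0 then \<bar>A l\<bar> - 1 else \<bar>A l\<bar>)"
  have h: "\<bar>A n\<bar> div 10 ^ (n - l) = h" if "n \<ge> N" for n
  proof -
    have "T n div 10 ^ (n - l) = (if T n < 0 then - 1 else 0)"
    proof (cases "T n < 0")
      case True
      have "(- 1 * 10 ^ (n - l) + (T n + 10 ^ (n - l))) div 10 ^ (n - l) = - 1"
        using T_bound [of n] N that True by (subst div_mult_self3) auto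
      then show ?thesis using True by simp
    next
      case False
      then show ?thesis
        using T_bound [of n] N that by simp
    qed
    moreover have "T n < 0 \<longleftrightarrow> T N < 0"
      using N that by (metis sgn_less)
    moreover have "\<bar>A n\<bar> = 10 ^ (n - l) * \<bar>A l\<bar> + T n"
      by (simp add: T_def)
    ultimately show ?thesis
      by (simp add: h_def)
  qed
  have "\<bar>A n\<bar> div 10 ^ (n - k) = h div 10 ^ (l - k)" if "n \<ge> N" for n
  proof -
    have eq: "n - k = (n - l) + (l - k)"
      using N that by (simp add: l_def)
    have "\<bar>A n\<bar> div 10 ^ (n - k) = \<bar>A n\<bar> div 10 ^ (n - l) div 10 ^ (l - k)"
      unfolding eq power_add by (rule zdiv_zmult2_eq) simp
    then show ?thesis using h that by simp
  qed
  then show ?thesis by blast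
qed

section \<open>Truncations scaled to integers\<close>

definition scaled_trunc :: "decimal \<Rightarrow> nat \<Rightarrow> int"
  where "scaled_trunc c n = decadic (shift (int n) (trunc c n))"

lemma shift_trunc_in_Z0: "shift (int n) (trunc c n) \<in> \<Z>\<^sub>0"
  by (simp add: \<Z>\<^sub>0_def digit_trunc)

text \<open>An index range independent of which digits vanish makes consecutive \<open>n\<close>
  comparable.\<close>

lemma scaled_trunc_lessThan:
  assumes K: "\<forall>i\<ge>int K. digit c i = 0"
  shows "scaled_trunc c n = sign_int (dsign c) * (\<Sum>i<K + n. digit c (int i - int n) * 10 ^ i)"
proof -
  have "(\<Sum>i | digit c (int i - int n) \<noteq> 0. digit c (int i - int n) * 10 ^ i)
      = (\<Sum>i<K + n. digit c (int i - int n) * 10 ^ i)"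
    by (rule sum.mono_neutral_left) (use K in \<open>auto simp: not_le [symmetric]\<close>)
  \<comment> \<open>A zero truncation has sign \<open>None\<close> instead of the sign of
    \<open>c\<close>; the formula survives because the sum is then 0.\<close>
  moreover have "(\<Sum>i<K + n. digit c (int i - int n) * 10 ^ i) = 0"
    if "\<forall>i\<ge>- int n. digit c i = 0"
    using that by simp
  ultimately show ?thesis
    by (auto simp: scaled_trunc_def decadic_def digit_trunc dsign_trunc)
qed

lemma digit_eventually_zero: "\<exists>K. \<forall>i\<ge>int K. digit c i = 0"
proof -
  obtain k where "\<forall>i>k. digit c i = 0"
    using digit_bounded by blast
  then show ?thesis
    by (intro exI [of _ "nat (k + 1)"]) auto
qed

text \<open>Passing to \<open>Suc n\<close> moves every digit up one place, and the summand split
  off at \<open>i = 0\<close> is the newly revealed digit.\<close>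

lemma scaled_trunc_Suc:
  "scaled_trunc c (Suc n) = 10 * scaled_trunc c n + sign_int (dsign c) * digit c (- int (Suc n))"
proof -
  obtain K where K: "\<forall>i\<ge>int K. digit c i = 0"
    using digit_eventually_zero by blast
  show ?thesis
    unfolding scaled_trunc_lessThan [OF K] add_Suc_right sum.lessThan_Suc_shift
    by (simp add: sum_distrib_left algebra_simps)
qed

lemma scaled_trunc_bound: "\<exists>B\<ge>0. \<forall>n. \<bar>scaled_trunc c n\<bar> \<le> B * 10 ^ n"
proof -
  have sg: "\<bar>sign_int (dsign c)\<bar> \<le> 1"
    by (cases "dsign c" rule: sign_int.cases) auto
  \<comment> \<open>The extra \<open>- 1\<close> makes the induction close: it becomes -10 and
    absorbs the new digit, at most 9.\<close>
  have "\<bar>scaled_trunc c n\<bar> \<le> (\<bar>scaled_trunc c 0\<bar> + 1) * 10 ^ n - 1" for n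
  proof (induction n)
    case (Suc n)
    have "\<bar>sign_int (dsign c) * digit c (- int (Suc n))\<bar> \<le> 1 * 9"
      unfolding abs_mult using sg digit_range by (intro mult_mono) auto
    then show ?case
      using Suc by (simp add: scaled_trunc_Suc)
  qed simp
  then have "\<bar>scaled_trunc c n\<bar> \<le> (\<bar>scaled_trunc c 0\<bar> + 1) * 10 ^ n" for n
    by (meson order_trans zle_diff1_eq less_imp_le)
  then show ?thesis
    by (intro exI [of _ "\<bar>scaled_trunc c 0\<bar> + 1"]) auto
qed

lemma sgn_scaled_trunc: "scaled_trunc c n = 0 \<or> sgn (scaled_trunc c n) = sign_int (dsign c)"
  using sgn_decadic [OF shift_trunc_in_Z0, of n c]
  by (auto simp: scaled_trunc_def dsign_trunc sgn_eq_0_iff split: if_splits)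

lemma abs_scaled_trunc: "\<bar>scaled_trunc c n\<bar> = sign_int (dsign c) * scaled_trunc c n"
  using sgn_scaled_trunc [of c n] by (metis abs_sgn abs_zero mult.commute mult_zero_right)

text \<open>The appended digit carries the sign of \<open>c\<close>, so after multiplication by that
  sign it is nonnegative.\<close>

lemma abs_scaled_trunc_Suc: "10 * \<bar>scaled_trunc c n\<bar> \<le> \<bar>scaled_trunc c (Suc n)\<bar>"
proof -
  have "0 \<le> sign_int (dsign c) * sign_int (dsign c) * digit c (- int (Suc n))"
    by (simp add: digit_range)
  then show ?thesis
    unfolding abs_scaled_trunc unfolding scaled_trunc_Suc by (simp add: algebra_simps)
qed

section \<open>Existence of the sum and the product\<close>

lemma flim_add_exists: "\<exists>s. is_flim (\<lambda>n. T_add (trunc c n) (trunc d n)) s"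
proof -
  define A where "A n = scaled_trunc c n + scaled_trunc d n" for n
  define \<sigma> \<tau> where "\<sigma> = sign_int (dsign c)" and "\<tau> = sign_int (dsign d)"
  have vals: "\<sigma> \<in> {- 1, 0, 1}" "\<tau> \<in> {- 1, 0, 1}"
    unfolding \<sigma>_def \<tau>_def
    by (cases "dsign c" rule: sign_int.cases; simp) (cases "dsign d" rule: sign_int.cases; simp)
  \<comment> \<open>The scale \<open>k = n\<close> turns both truncations into integers, and the
    outer shift cancels the \<open>shift (- n)\<close> in the sum.\<close>
  have T: "shift (int n) (T_add (trunc c n) (trunc d n))
      = the_inv_into \<Z>\<^sub>0 decadic (A n)" for n
    by (simp add: T_add_eq [OF shift_trunc_in_Z0 shift_trunc_in_Z0] Z_add_def A_def scaled_trunc_def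
        flip: shift_shift) (rule decimal_eqI; simp)
  have stab: "(\<exists>N. \<forall>n\<ge>N. sgn (A n) = sgn (A N)) \<and>
      (\<forall>k. \<exists>N g. \<forall>n\<ge>N. \<bar>A n\<bar> div 10 ^ (1 * n - k) = g)"
  \<comment> \<open>Opposite nonzero signs are the only case with cancellation. There
    \<open>e n\<close> is, up to sign, a difference of two digits, hence at most 9 in absolute
    value; for equal signs it could reach 18.\<close>
  proof (cases "\<sigma> * \<tau> = - 1")
    case True
    define e where "e n = \<sigma> * digit c (- int (Suc n)) + \<tau> * digit d (- int (Suc n))" for n
    have "A (Suc n) = 10 * A n + e n" for n
      by (simp add: A_def e_def \<sigma>_def \<tau>_def scaled_trunc_Suc)
    moreover have "\<bar>e n\<bar> \<le> 9" for n
      using True vals digit_range [of c "- int (Suc n)"] digit_range [of d "- int (Suc n)"]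
      by (auto simp: e_def)
    ultimately show ?thesis
      using digit_recursion_sgn_stabilises [of 0 A e] digit_recursion_quotient_stabilises [of A e]
      by auto
  next
    case False
    have c: "scaled_trunc c n = 0 \<or> sgn (scaled_trunc c n) = \<sigma>" for n
      unfolding \<sigma>_def by (rule sgn_scaled_trunc)
    have d: "scaled_trunc d n = 0 \<or> sgn (scaled_trunc d n) = \<tau>" for n
      unfolding \<tau>_def by (rule sgn_scaled_trunc)
    have abs: "\<bar>A n\<bar> = \<bar>scaled_trunc c n\<bar> + \<bar>scaled_trunc d n\<bar>" for n
      using False c [of n] d [of n] by (auto simp: A_def sgn_if split: if_splits)
    \<comment> \<open>If \<open>c\<close> is zero, the sum takes the sign of \<open>d\<close>;
      otherwise \<open>d\<close> is zero or has the same sign as \<open>c\<close>.\<close>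
    have sg: "A n = 0 \<or> sgn (A n) = (if \<sigma> = 0 then \<tau> else \<sigma>)" for n
      using False vals c [of n] d [of n] by (auto simp: A_def sgn_if split: if_splits)
    obtain B1 B2 where "\<forall>n. \<bar>scaled_trunc c n\<bar> \<le> B1 * 10 ^ n" "\<forall>n. \<bar>scaled_trunc d n\<bar> \<le> B2 * 10 ^ n"
      using scaled_trunc_bound by meson
    then have bound: "\<bar>A n\<bar> \<le> (B1 + B2) * 10 ^ (1 * n)" for n
      unfolding abs by (simp add: add_mono distrib_right)
    have step: "10 ^ 1 * \<bar>A n\<bar> \<le> \<bar>A (Suc n)\<bar>" for n
      unfolding abs using abs_scaled_trunc_Suc [of c n] abs_scaled_trunc_Suc [of d n] by simp
    show ?thesis
      using superhomogeneous_sgn [of 1 A, OF step sg]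
        superhomogeneous_quotient_stabilises [of 1 A, OF zero_less_one step bound] by blast
  qed
  show ?thesis
    by (rule flim_exists_if_scaled_stabilise [of 1 _ A]) (use stab T the_inv_decadic in auto)
qed

text \<open>Each factor contributes a scale of 10^n, hence \<open>r = 2\<close>. Absolute values
  multiply, so the growth of the two factors combines without cancellation, whatever the
  signs.\<close>

lemma flim_mult_exists: "\<exists>p. is_flim (\<lambda>n. T_mult (trunc c n) (trunc d n)) p"
proof -
  define A where "A n = scaled_trunc c n * scaled_trunc d n" for n
  have T: "shift (int (2 * n)) (T_mult (trunc c n) (trunc d n))
      = the_inv_into \<Z>\<^sub>0 decadic (A n)" for n
    by (simp add: T_mult_eq [OF shift_trunc_in_Z0 shift_trunc_in_Z0] Z_mult_def A_def
        scaled_trunc_def) (rule decimal_eqI; simp)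
  obtain B1 B2 where B: "B1 \<ge> 0" "\<forall>n. \<bar>scaled_trunc c n\<bar> \<le> B1 * 10 ^ n"
    "\<forall>n. \<bar>scaled_trunc d n\<bar> \<le> B2 * 10 ^ n"
    using scaled_trunc_bound by meson
  have bound: "\<bar>A n\<bar> \<le> (B1 * B2) * 10 ^ (2 * n)" for n
  proof -
    have "\<bar>A n\<bar> \<le> (B1 * 10 ^ n) * (B2 * 10 ^ n)"
      unfolding A_def abs_mult using B by (intro mult_mono) auto
    then show ?thesis
      by (simp only: mult_2 power_add mult.assoc mult.left_commute)
  qed
  have step: "10 ^ 2 * \<bar>A n\<bar> \<le> \<bar>A (Suc n)\<bar>" for n
  proof -
    have "(10 * \<bar>scaled_trunc c n\<bar>) * (10 * \<bar>scaled_trunc d n\<bar>)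
        \<le> \<bar>scaled_trunc c (Suc n)\<bar> * \<bar>scaled_trunc d (Suc n)\<bar>"
      by (intro mult_mono abs_scaled_trunc_Suc) auto
    then show ?thesis
      by (simp add: A_def abs_mult)
  qed
  have sg: "A n = 0 \<or> sgn (A n) = sign_int (dsign c) * sign_int (dsign d)" for n
    using sgn_scaled_trunc [of c n] sgn_scaled_trunc [of d n] by (auto simp: A_def sgn_mult)
  show ?thesis
  proof (rule flim_exists_if_scaled_stabilise [of 2 _ A])
    show "\<exists>N. \<forall>n\<ge>N. sgn (A n) = sgn (A N)"
      by (rule superhomogeneous_sgn [of 2 A, OF step sg])
    show "\<exists>N g. \<forall>n\<ge>N. \<bar>A n\<bar> div 10 ^ (2 * n - k) = g" for k
      by (rule superhomogeneous_quotient_stabilises [of 2 A, OF _ step bound]) simp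
  qed (use T the_inv_decadic in auto)
qed

theorem proposition2p16:
  fixes c d :: decimal
  shows "(\<exists>s. is_flim (\<lambda>n. T_add (trunc c n) (trunc d n)) s) \<and>
         (\<exists>p. is_flim (\<lambda>n. T_mult (trunc c n) (trunc d n)) p)"
  using flim_add_exists flim_mult_exists by blast

end
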